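(* Let $m>0$. For every $a\in\mathbb{R}$ with $a^2\le m^2$ and every $\epsilon>0$, the region $$M^a_\epsilon=\mathbb{R}\times\{x\in\mathbb{R}^3: r>m+\sqrt{m^2+\epsilon-a^2\cos^2\theta}\}$$ of Kerr spacetime is not space convex.
   Context: $(r,\theta,\varphi)$ are the usual spherical coordinates on $\mathbb{R}^3$ and $t$ is the coordinate on the factor $\mathbb{R}$ (Boyer–Lindquist coordinates). The Kerr metric with mass $m>0$ and angular momentum $ma$ is $$ds^2=g_{4,4}\,dt^2+g_{1,1}\,dr^2+g_{2,2}\,d\theta^2+g_{3,3}\,d\varphi^2+2g_{3,4}\,dt\,d\varphi,$$ with $\lambda(r,\theta)=r^2+a^2\cos^2\theta$, $\triangle(r)=r^2-2mr+a^2$, and $$g_{1,1}=\frac{\lambda}{\triangle},\quad g_{2,2}=\lambda,\quad g_{3,3}=\Big[r^2+a^2+\frac{2mra^2\sin^2\theta}{\lambda}\Big]\sin^2\theta,\quad g_{3,4}=-\frac{2mra\sin^2\theta}{\lambda},\quad g_{4,4}=-1+\frac{2mr}{\lambda}.$$ It is considered on $M^a=\mathbb{R}\times\{x\in\mathbb{R}^3: r>m+\sqrt{m^2-a^2\cos^2\theta}\}$, which contains $M^a_\epsilon$ and its boundary $\partial M^a_\epsilon$; the metric extends smoothly across the axis $\theta\in\{0,\pi\}$. Put $\phi_a(r,\theta)=\frac12(r^2-2mr+a^2\cos^2\theta)$, so that $\partial M^a_\epsilon=\{\phi_a=\epsilon/2\}$ in $M^a$ is a smooth hypersurface and $\phi_a>\epsilon/2$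 on $M^a_\epsilon$. $M^a_\epsilon$ is called space convex if $\mathrm{Hess}_{\phi_a}(p)[\tilde v,\tilde v]\le 0$ for every $p\in\partial M^a_\epsilon$ and every spacelike vector $\tilde v\in T_p\,\partial M^a_\epsilon$ (spacelike meaning $ds^2(\tilde v,\tilde v)>0$), where $\mathrm{Hess}_{\phi_a}$ is the Hessian with respect to the Kerr metric. *)

theory Defs
  imports "HOL-Analysis.Analysis"
begin

section \<open>Tensor calculus in a global chart\<close>

text \<open>A (pseudo-Riemannian) metric on an open subset of \<open>real^'n\<close> is given by its Gram matrix
  \<open>g p\<close> in the standard coordinates.\<close>

definition partial :: "'n::finite \<Rightarrow> (real^'n \<Rightarrow> real) \<Rightarrow> real^'n \<Rightarrow> real" where
  "partial i f p = deriv (\<lambda>s. f (p + s *\<^sub>R axis i 1)) 0"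

definition metric_form :: "(real^'n \<Rightarrow> real^'n^'n) \<Rightarrow> real^'n \<Rightarrow> real^'n \<Rightarrow> real^'n \<Rightarrow> real" where
  "metric_form g p v w = (\<Sum>i\<in>UNIV. \<Sum>j\<in>UNIV. g p $ i $ j * v $ i * w $ j)"

text \<open>\<open>christoffel g k i j\<close> is the symbol with upper index \<open>k\<close> and lower indices \<open>i\<close>, \<open>j\<close>.\<close>

definition christoffel ::
    "(real^'n \<Rightarrow> real^'n^'n) \<Rightarrow> 'n::finite \<Rightarrow> 'n \<Rightarrow> 'n \<Rightarrow> real^'n \<Rightarrow> real" where
  "christoffel g k i j p =
     (1/2) * (\<Sum>l\<in>UNIV. matrix_inv (g p) $ k $ l *
       (partial i (\<lambda>q. g q $ j $ l) p + partial j (\<lambda>q. g q $ i $ l) p - partial l (\<lambda>q. g q $ i $ j) p))"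

text \<open>The covariant Hessian, i.e. the covariant derivative of the differential of \<open>f\<close>.\<close>

definition hessian ::
    "(real^'n \<Rightarrow> real^'n^'n) \<Rightarrow> (real^'n \<Rightarrow> real) \<Rightarrow> real^'n \<Rightarrow> real^'n \<Rightarrow> real^'n \<Rightarrow> real" where
  "hessian g f p v w =
     (\<Sum>i\<in>UNIV. \<Sum>j\<in>UNIV.
       (partial i (partial j f) p - (\<Sum>k\<in>UNIV. christoffel g k i j p * partial k f p)) * v $ i * w $ j)"

text \<open>Velocities of curves in \<open>S\<close>; this is the tangent space whenever \<open>S\<close> is a smooth
  embedded hypersurface.\<close>

definition tangent_vectors :: "'a::real_normed_vector set \<Rightarrow> 'a \<Rightarrow> 'a set" where
  "tangent_vectors S p =
     {v. \<exists>\<gamma>::real \<Rightarrow> 'a. \<gamma> 0 = p \<and> (\<forall>\<^sub>F s in nhds 0. \<gamma> s \<in> S) \<and> (\<gamma> has_vector_derivative v) (at 0)}"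

definition space_convex :: "(real^'n \<Rightarrow> real^'n^'n) \<Rightarrow> (real^'n \<Rightarrow> real) \<Rightarrow> (real^'n) set \<Rightarrow> bool" where
  "space_convex g \<phi> M \<longleftrightarrow>
     (\<forall>p\<in>frontier M. \<forall>v\<in>tangent_vectors (frontier M) p.
        metric_form g p v v > 0 \<longrightarrow> hessian g \<phi> p v v \<le> 0)"


section \<open>Kerr spacetime\<close>

text \<open>Points of \<open>real^4\<close> are \<open>(x, y, z, t)\<close>: the components 1, 2, 3 are the Cartesian coordinates of
  the spatial factor and 4 is the time coordinate.\<close>

definition radius :: "real^4 \<Rightarrow> real" where
  "radius p = sqrt ((p$1)\<^sup>2 + (p$2)\<^sup>2 + (p$3)\<^sup>2)"

definition colat :: "real^4 \<Rightarrow> real" where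
  "colat p = arccos (p$3 / radius p)"

definition spherical :: "real \<Rightarrow> real \<Rightarrow> real \<Rightarrow> real \<Rightarrow> real^4" where
  "spherical r \<theta> \<phi> t = vector [r * sin \<theta> * cos \<phi>, r * sin \<theta> * sin \<phi>, r * cos \<theta>, t]"

definition kerr_lambda :: "real \<Rightarrow> real \<Rightarrow> real \<Rightarrow> real" where
  "kerr_lambda a r \<theta> = r\<^sup>2 + a\<^sup>2 * (cos \<theta>)\<^sup>2"

definition kerr_Delta :: "real \<Rightarrow> real \<Rightarrow> real \<Rightarrow> real" where
  "kerr_Delta m a r = r\<^sup>2 - 2 * m * r + a\<^sup>2"

definition kerr_g11 :: "real \<Rightarrow> real \<Rightarrow> real \<Rightarrow> real \<Rightarrow> real" where
  "kerr_g11 m a r \<theta> = kerr_lambda a r \<theta> / kerr_Delta m a r"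

definition kerr_g22 :: "real \<Rightarrow> real \<Rightarrow> real \<Rightarrow> real \<Rightarrow> real" where
  "kerr_g22 m a r \<theta> = kerr_lambda a r \<theta>"

definition kerr_g33 :: "real \<Rightarrow> real \<Rightarrow> real \<Rightarrow> real \<Rightarrow> real" where
  "kerr_g33 m a r \<theta> =
     (r\<^sup>2 + a\<^sup>2 + 2 * m * r * a\<^sup>2 * (sin \<theta>)\<^sup>2 / kerr_lambda a r \<theta>) * (sin \<theta>)\<^sup>2"

definition kerr_g34 :: "real \<Rightarrow> real \<Rightarrow> real \<Rightarrow> real \<Rightarrow> real" where
  "kerr_g34 m a r \<theta> = - (2 * m * r * a * (sin \<theta>)\<^sup>2 / kerr_lambda a r \<theta>)"

definition kerr_g44 :: "real \<Rightarrow> real \<Rightarrow> real \<Rightarrow> real \<Rightarrow> real" where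
  "kerr_g44 m a r \<theta> = - 1 + 2 * m * r / kerr_lambda a r \<theta>"

text \<open>The Cartesian components of the coordinate one-forms of \<open>r\<close>, \<open>\<theta>\<close>, \<open>\<phi>\<close> off the axis.\<close>

definition d_radius :: "real^4 \<Rightarrow> real^4" where
  "d_radius p = vector [p$1 / radius p, p$2 / radius p, p$3 / radius p, 0]"

definition d_colat :: "real^4 \<Rightarrow> real^4" where
  "d_colat p = (let r = radius p; \<rho> = sqrt ((p$1)\<^sup>2 + (p$2)\<^sup>2) in
     vector [p$1 * p$3 / (r\<^sup>2 * \<rho>), p$2 * p$3 / (r\<^sup>2 * \<rho>), - \<rho> / r\<^sup>2, 0])"

definition d_azimuth :: "real^4 \<Rightarrow> real^4" where
  "d_azimuth p = (let \<rho> = sqrt ((p$1)\<^sup>2 + (p$2)\<^sup>2) in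
     vector [- p$2 / \<rho>\<^sup>2, p$1 / \<rho>\<^sup>2, 0, 0])"

definition d_time :: "real^4" where
  "d_time = vector [0, 0, 0, 1]"

definition kerr_off_axis :: "real \<Rightarrow> real \<Rightarrow> real^4 \<Rightarrow> real^4^4" where
  "kerr_off_axis m a p = (let r = radius p; \<theta> = colat p in
     \<chi> i j. kerr_g44 m a r \<theta> * d_time$i * d_time$j
         + kerr_g11 m a r \<theta> * d_radius p$i * d_radius p$j
         + kerr_g22 m a r \<theta> * d_colat p$i * d_colat p$j
         + kerr_g33 m a r \<theta> * d_azimuth p$i * d_azimuth p$j
         + kerr_g34 m a r \<theta> * (d_time$i * d_azimuth p$j + d_azimuth p$i * d_time$j))"

definition kerr_axis :: "(real^4) set" where
  "kerr_axis = {p. p$1 = 0 \<and> p$2 = 0}"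

text \<open>On the axis the metric is the continuous extension. That the limit exists in the exterior
  region, and that the resulting metric is smooth there, is visible from \<open>kerr_metric_closed_form\<close>
  below.\<close>

definition kerr_metric :: "real \<Rightarrow> real \<Rightarrow> real^4 \<Rightarrow> real^4^4" where
  "kerr_metric m a p =
     (if p \<in> kerr_axis then Lim (at p within - kerr_axis) (kerr_off_axis m a) else kerr_off_axis m a p)"

definition kerr_exterior :: "real \<Rightarrow> real \<Rightarrow> (real^4) set" where
  "kerr_exterior m a = {p. radius p > m + sqrt (m\<^sup>2 - a\<^sup>2 * (cos (colat p))\<^sup>2)}"

definition kerr_region :: "real \<Rightarrow> real \<Rightarrow> real \<Rightarrow> (real^4) set" where
  "kerr_region m a \<epsilon> = {p. radius p > m + sqrt (m\<^sup>2 + \<epsilon> - a\<^sup>2 * (cos (colat p))\<^sup>2)}"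

definition kerr_phi :: "real \<Rightarrow> real \<Rightarrow> real^4 \<Rightarrow> real" where
  "kerr_phi m a p =
     (1/2) * ((radius p)\<^sup>2 - 2 * m * radius p + a\<^sup>2 * (cos (colat p))\<^sup>2)"


section \<open>Consistency of the definitions\<close>

lemma vector_4 [simp]:
  "(vector [x, y, z, t] :: 'a::zero^4) $ 1 = x"
  "(vector [x, y, z, t] :: 'a::zero^4) $ 2 = y"
  "(vector [x, y, z, t] :: 'a::zero^4) $ 3 = z"
  "(vector [x, y, z, t] :: 'a::zero^4) $ 4 = t"
  unfolding vector_def by simp_all

lemma radius_nonneg [simp]: "0 \<le> radius p"
  by (simp add: radius_def)

lemma radius_sq: "(radius p)\<^sup>2 = (p$1)\<^sup>2 + (p$2)\<^sup>2 + (p$3)\<^sup>2"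
  by (simp add: radius_def)

lemma cos_colat: "cos (colat p) = p$3 / radius p"
proof -
  have "\<bar>p$3\<bar> \<le> radius p"
    unfolding radius_def by (rule real_le_rsqrt) simp
  then have "\<bar>p$3 / radius p\<bar> \<le> 1"
    by (cases "radius p = 0") (auto simp: field_simps)
  then show ?thesis
    unfolding colat_def by (rule cos_arccos_abs)
qed

lemma sin_colat_sq:
  assumes "radius p \<noteq> 0"
  shows "(sin (colat p))\<^sup>2 = ((p$1)\<^sup>2 + (p$2)\<^sup>2) / (radius p)\<^sup>2"
proof -
  have "(p$1)\<^sup>2 + (p$2)\<^sup>2 = (radius p)\<^sup>2 - (p$3)\<^sup>2"
    by (simp add: radius_sq)
  then show ?thesis
    using assms by (simp add: sin_squared_eq cos_colat power_divide diff_divide_distrib)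
qed

lemma radius_spherical:
  assumes "0 \<le> r"
  shows "radius (spherical r \<theta> \<phi> t) = r"
proof -
  have "(r * sin \<theta> * cos \<phi>)\<^sup>2 + (r * sin \<theta> * sin \<phi>)\<^sup>2 + (r * cos \<theta>)\<^sup>2
      = r\<^sup>2 * ((sin \<theta>)\<^sup>2 * ((cos \<phi>)\<^sup>2 + (sin \<phi>)\<^sup>2) + (cos \<theta>)\<^sup>2)"
    by algebra
  then show ?thesis
    using assms by (simp add: radius_def spherical_def)
qed

lemma colat_spherical:
  assumes "0 < r" "0 \<le> \<theta>" "\<theta> \<le> pi"
  shows "colat (spherical r \<theta> \<phi> t) = \<theta>"
  using assms radius_spherical[of r \<theta> \<phi> t] by (simp add: colat_def spherical_def arccos_cos)

text \<open>Along a curve off the axis the metric is the Boyer--Lindquist line element.\<close>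

lemma kerr_line_element:
  assumes R: "(R has_real_derivative R') (at s)"
    and Th: "(\<Theta> has_real_derivative \<Theta>') (at s)"
    and Ph: "(\<Phi> has_real_derivative \<Phi>') (at s)"
    and T: "(T has_real_derivative T') (at s)"
    and pos: "0 < R s" "0 < \<Theta> s" "\<Theta> s < pi"
  defines "\<gamma> \<equiv> \<lambda>s. spherical (R s) (\<Theta> s) (\<Phi> s) (T s)"
  defines "v \<equiv> vector_derivative \<gamma> (at s)"
  shows "(\<gamma> has_vector_derivative v) (at s)"
    and "metric_form (kerr_metric m a) (\<gamma> s) v v =
           kerr_g44 m a (R s) (\<Theta> s) * T'\<^sup>2 + kerr_g11 m a (R s) (\<Theta> s) * R'\<^sup>2
         + kerr_g22 m a (R s) (\<Theta> s) * \<Theta>'\<^sup>2 + kerr_g33 m a (R s) (\<Theta> s) * \<Phi>'\<^sup>2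
         + 2 * kerr_g34 m a (R s) (\<Theta> s) * T' * \<Phi>'"
proof -
  define r \<theta> \<phi> where "r = R s" and "\<theta> = \<Theta> s" and "\<phi> = \<Phi> s"
  define S C s' c' where "S = sin \<theta>" and "C = cos \<theta>" and "s' = sin \<phi>" and "c' = cos \<phi>"
  define w :: "real^4" where
    "w = vector [R' * S * c' + r * C * \<Theta>' * c' - r * S * s' * \<Phi>',
                 R' * S * s' + r * C * \<Theta>' * s' + r * S * c' * \<Phi>',
                 R' * C - r * S * \<Theta>', T']"
  have comp: "((\<lambda>s. \<gamma> s $ i) has_vector_derivative w $ i) (at s)" for i
    unfolding has_real_derivative_iff_has_vector_derivative[symmetric]
    using exhaust_4[of i] R Th Ph T
    by (auto simp: \<gamma>_def spherical_def w_def r_def \<theta>_def \<phi>_def S_def C_def s'_def c'_def algebra_simps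
        intro!: derivative_eq_intros)
  have "(\<gamma> has_vector_derivative w) (at s)"
    unfolding has_vector_derivative_def has_derivative_componentwise_within[of \<gamma>]
  proof
    fix b :: "real^4" assume "b \<in> Basis"
    then obtain i where b: "b = axis i 1"
      by (auto simp: Basis_vec_def)
    show "((\<lambda>x. \<gamma> x \<bullet> b) has_derivative (\<lambda>x. x *\<^sub>R w \<bullet> b)) (at s)"
      using comp[of i] by (simp add: b inner_axis has_vector_derivative_def)
  qed
  moreover from this have vw: "v = w"
    unfolding v_def by (rule vector_derivative_at)
  ultimately show "(\<gamma> has_vector_derivative v) (at s)"
    by simp
  have r: "r > 0" and S: "S > 0" and SC: "S\<^sup>2 + C\<^sup>2 = 1" and sc: "s'\<^sup>2 + c'\<^sup>2 = 1"
    using pos sin_gt_zero by (auto simp: r_def S_def C_def s'_def c'_def \<theta>_def)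
  define p where "p = \<gamma> s"
  have p: "p = vector [r * S * c', r * S * s', r * C, T s]"
    by (simp add: p_def \<gamma>_def spherical_def r_def S_def C_def s'_def c'_def \<theta>_def \<phi>_def)
  have rad: "radius p = r" and col: "colat p = \<theta>"
    using pos by (simp_all add: p_def \<gamma>_def radius_spherical colat_spherical r_def \<theta>_def)
  have eq: "(p$1)\<^sup>2 + (p$2)\<^sup>2 = (r * S)\<^sup>2"
  proof -
    have "(p$1)\<^sup>2 + (p$2)\<^sup>2 = (r * S)\<^sup>2 * (s'\<^sup>2 + c'\<^sup>2)"
      by (simp add: p power_mult_distrib algebra_simps)
    then show ?thesis
      by (simp add: sc)
  qed
  then have rho: "sqrt ((p$1)\<^sup>2 + (p$2)\<^sup>2) = r * S"
    using r S by simp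
  have off: "p \<notin> kerr_axis"
    using eq r S by (auto simp: kerr_axis_def)
  have dr: "d_radius p = vector [S * c', S * s', C, 0]"
    using r unfolding d_radius_def rad by (simp add: p)
  have dth: "d_colat p = vector [C * c' / r, C * s' / r, - S / r, 0]"
    using r S unfolding d_colat_def Let_def rho rad by (simp add: p power2_eq_square mult.commute)
  have dph: "d_azimuth p = vector [- s' / (r * S), c' / (r * S), 0, 0]"
    using r S unfolding d_azimuth_def Let_def rho by (simp add: p power2_eq_square)
  define D where "D \<equiv> \<lambda>u::real^4. \<Sum>i\<in>UNIV. u $ i * w $ i"
  have Dr: "D (d_radius p) = R'"
  proof -
    have "D (d_radius p) = R' * (S\<^sup>2 * (s'\<^sup>2 + c'\<^sup>2) + C\<^sup>2) + r * S * C * \<Theta>' * (s'\<^sup>2 + c'\<^sup>2 - 1)"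
      by (simp add: D_def sum_4 dr w_def power2_eq_square algebra_simps)
    then show ?thesis
      by (simp add: sc SC)
  qed
  have Dth: "D (d_colat p) = \<Theta>'"
  proof -
    have "r * D (d_colat p) = r * \<Theta>' * (C\<^sup>2 * (s'\<^sup>2 + c'\<^sup>2) + S\<^sup>2) + R' * S * C * (s'\<^sup>2 + c'\<^sup>2 - 1)"
      using r by (simp add: D_def sum_4 dth w_def power2_eq_square field_simps)
    also have "\<dots> = r * \<Theta>'"
      using SC by (simp add: sc add.commute[of "C\<^sup>2"])
    finally show ?thesis
      using r by simp
  qed
  have Dph: "D (d_azimuth p) = \<Phi>'"
  proof -
    have "r * S * D (d_azimuth p) = r * S * \<Phi>' * (s'\<^sup>2 + c'\<^sup>2)"
      using r S by (simp add: D_def sum_4 dph w_def power2_eq_square field_simps)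
    then show ?thesis
      using r S by (simp add: sc)
  qed
  have Dt: "D d_time = T'"
    by (simp add: D_def sum_4 d_time_def w_def)
  have "metric_form (kerr_metric m a) p w w =
           kerr_g44 m a r \<theta> * (D d_time)\<^sup>2 + kerr_g11 m a r \<theta> * (D (d_radius p))\<^sup>2
         + kerr_g22 m a r \<theta> * (D (d_colat p))\<^sup>2 + kerr_g33 m a r \<theta> * (D (d_azimuth p))\<^sup>2
         + 2 * kerr_g34 m a r \<theta> * D d_time * D (d_azimuth p)"
    using off
    by (simp add: metric_form_def kerr_metric_def kerr_off_axis_def Let_def rad col D_def
        sum_4 power2_eq_square algebra_simps)
  from this[unfolded Dr Dth Dph Dt]
  show "metric_form (kerr_metric m a) (\<gamma> s) v v =
           kerr_g44 m a (R s) (\<Theta> s) * T'\<^sup>2 + kerr_g11 m a (R s) (\<Theta> s) * R'\<^sup>2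
         + kerr_g22 m a (R s) (\<Theta> s) * \<Theta>'\<^sup>2 + kerr_g33 m a (R s) (\<Theta> s) * \<Phi>'\<^sup>2
         + 2 * kerr_g34 m a (R s) (\<Theta> s) * T' * \<Phi>'"
    unfolding vw p_def r_def \<theta>_def .
qed

definition kerr_closed_form :: "real \<Rightarrow> real \<Rightarrow> real^4 \<Rightarrow> real^4^4" where
  "kerr_closed_form m a p =
    (let r = radius p; \<Lambda> = r\<^sup>2 + a\<^sup>2 * (p$3)\<^sup>2 / r\<^sup>2;
         n = d_radius p; w = vector [- p$2 / r\<^sup>2, p$1 / r\<^sup>2, 0, 0] :: real^4
     in \<chi> i j. (- 1 + 2 * m * r / \<Lambda>) * d_time$i * d_time$j
         + \<Lambda> / (r\<^sup>2 - 2 * m * r + a\<^sup>2) * n$i * n$j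
         + \<Lambda> / r\<^sup>2 * ((if i = j \<and> i \<noteq> 4 then 1 else 0) - n$i * n$j)
         + a\<^sup>2 * (1 + 2 * m * r / \<Lambda>) * w$i * w$j
         - 2 * m * r * a / \<Lambda> * (d_time$i * w$j + w$i * d_time$j))"

lemma kerr_off_axis_closed_form:
  assumes "p \<notin> kerr_axis"
  shows "kerr_off_axis m a p = kerr_closed_form m a p"
proof -
  define r x y z where "r = radius p" and "x = p$1" and "y = p$2" and "z = p$3"
  define \<rho> where "\<rho> = sqrt (x\<^sup>2 + y\<^sup>2)"
  have "x\<^sup>2 + y\<^sup>2 > 0"
    using assms by (auto simp: kerr_axis_def x_def y_def sum_power2_gt_zero_iff)
  then have \<rho>: "\<rho> > 0" and \<rho>2: "\<rho>\<^sup>2 = x\<^sup>2 + y\<^sup>2"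
    by (auto simp: \<rho>_def)
  have r2: "r\<^sup>2 = \<rho>\<^sup>2 + z\<^sup>2"
    by (simp add: \<rho>2 r_def radius_sq x_def y_def z_def)
  have r: "r > 0"
    using \<rho> r2 by (smt (verit) radius_nonneg r_def zero_less_power2 zero_le_power2 power2_eq_square mult_zero_left)
  define \<Lambda> where "\<Lambda> = r\<^sup>2 + a\<^sup>2 * z\<^sup>2 / r\<^sup>2"
  define \<sigma> where "\<sigma> = \<rho>\<^sup>2 / r\<^sup>2"
  have lam: "kerr_lambda a r (colat p) = \<Lambda>"
    by (simp add: kerr_lambda_def cos_colat \<Lambda>_def r_def z_def power_divide)
  have sin2: "(sin (colat p))\<^sup>2 = \<sigma>"
    using sin_colat_sq[of p] r by (simp add: \<sigma>_def \<rho>2 r_def x_def y_def)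
  define n th az w :: "real^4" where "n = d_radius p" and "th = d_colat p" and "az = d_azimuth p"
    and "w = vector [- y / r\<^sup>2, x / r\<^sup>2, 0, 0]"
  have w: "w $ i = \<sigma> * az $ i" for i
    using exhaust_4[of i] \<rho> r
    unfolding w_def az_def d_azimuth_def Let_def x_def[symmetric] y_def[symmetric] \<rho>_def[symmetric] \<sigma>_def
    by (elim disjE) simp_all
  have ang: "th $ i * th $ j + \<sigma> * az $ i * az $ j = ((if i = j \<and> i \<noteq> 4 then 1 else 0) - n $ i * n $ j) / r\<^sup>2"
    (is "?L = ?R") for i j
  proof -
    have "r\<^sup>2 * r\<^sup>2 * \<rho>\<^sup>2 * ?L = r\<^sup>2 * r\<^sup>2 * \<rho>\<^sup>2 * ?R"
    proof -
      have az': "az $ k * \<rho>\<^sup>2 = vector [-y, x, 0, 0] $ k" for k :: 4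
        using exhaust_4[of k] \<rho>
        unfolding az_def d_azimuth_def Let_def x_def[symmetric] y_def[symmetric] \<rho>_def[symmetric]
        by (elim disjE) simp_all
      have th': "th $ k * (r\<^sup>2 * \<rho>) = vector [x * z, y * z, - \<rho>\<^sup>2, 0] $ k" for k :: 4
        using exhaust_4[of k] \<rho> r
        unfolding th_def d_colat_def Let_def r_def[symmetric] x_def[symmetric]
          y_def[symmetric] z_def[symmetric] \<rho>_def[symmetric]
        by (elim disjE) (simp_all add: power2_eq_square)
      have n': "n $ k * r = vector [x, y, z, 0] $ k" for k :: 4
        using exhaust_4[of k] r
        unfolding n_def d_radius_def r_def[symmetric] x_def[symmetric] y_def[symmetric] z_def[symmetric]
        by (elim disjE) simp_all
      have "r\<^sup>2 * r\<^sup>2 * \<rho>\<^sup>2 * ?L = (th $ i * (r\<^sup>2 * \<rho>)) * (th $ j * (r\<^sup>2 * \<rho>))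
          + r\<^sup>2 * (az $ i * \<rho>\<^sup>2) * (az $ j * \<rho>\<^sup>2)"
        using r by (simp add: \<sigma>_def power2_eq_square field_simps)
      also have "\<dots> = \<rho>\<^sup>2 * (r\<^sup>2 * (if i = j \<and> i \<noteq> 4 then 1 else 0) - (n $ i * r) * (n $ j * r))"
        unfolding az' th' n'
        unfolding r2 \<rho>2
        using exhaust_4[of i] exhaust_4[of j]
        by (elim disjE) (simp_all add: power2_eq_square algebra_simps)
      also have "\<dots> = r\<^sup>2 * r\<^sup>2 * \<rho>\<^sup>2 * ?R"
        using r by (simp add: power2_eq_square field_simps)
      finally show ?thesis .
    qed
    moreover have "r\<^sup>2 * r\<^sup>2 * \<rho>\<^sup>2 \<noteq> 0"
      using r \<rho> by simp
    ultimately show ?thesis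
      using mult_left_cancel by blast
  qed
  have g33: "kerr_g33 m a r (colat p) = \<Lambda> * \<sigma> + a\<^sup>2 * (1 + 2 * m * r / \<Lambda>) * \<sigma> * \<sigma>"
  proof -
    have "z\<^sup>2 = r\<^sup>2 - \<rho>\<^sup>2"
      by (simp add: r2)
    then have "z\<^sup>2 / r\<^sup>2 = 1 - \<sigma>"
      using r by (simp add: \<sigma>_def diff_divide_distrib)
    then have "a\<^sup>2 * z\<^sup>2 / r\<^sup>2 = a\<^sup>2 * (1 - \<sigma>)"
      by (metis times_divide_eq_right)
    then have \<Lambda>': "\<Lambda> = r\<^sup>2 + a\<^sup>2 * (1 - \<sigma>)"
      by (simp add: \<Lambda>_def)
    have "kerr_g33 m a r (colat p) = (r\<^sup>2 + a\<^sup>2) * \<sigma> + a\<^sup>2 * (2 * m * r / \<Lambda>) * \<sigma> * \<sigma>"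
      unfolding kerr_g33_def lam sin2 by (simp add: algebra_simps)
    also have "(r\<^sup>2 + a\<^sup>2) * \<sigma> = \<Lambda> * \<sigma> + a\<^sup>2 * \<sigma> * \<sigma>"
      by (simp add: \<Lambda>' algebra_simps)
    finally show ?thesis
      by (simp add: algebra_simps)
  qed
  have "kerr_off_axis m a p $ i $ j = kerr_closed_form m a p $ i $ j" for i j
  proof -
    have "kerr_off_axis m a p $ i $ j
       = (- 1 + 2 * m * r / \<Lambda>) * d_time$i * d_time$j
         + \<Lambda> / (r\<^sup>2 - 2 * m * r + a\<^sup>2) * n$i * n$j
         + \<Lambda> * (th $ i * th $ j + \<sigma> * az $ i * az $ j)
         + a\<^sup>2 * (1 + 2 * m * r / \<Lambda>) * (\<sigma> * az $ i) * (\<sigma> * az $ j)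
         - 2 * m * r * a / \<Lambda> * (d_time$i * (\<sigma> * az $ j) + (\<sigma> * az $ i) * d_time$j)"
      unfolding kerr_off_axis_def Let_def g33 kerr_g44_def kerr_g11_def kerr_g22_def kerr_g34_def
        kerr_Delta_def lam sin2 r_def[symmetric] n_def[symmetric] th_def[symmetric] az_def[symmetric]
      by (simp add: algebra_simps)
    also have "\<dots> = kerr_closed_form m a p $ i $ j"
      unfolding ang
      unfolding w[symmetric] kerr_closed_form_def Let_def
        r_def[symmetric] n_def[symmetric] x_def[symmetric] y_def[symmetric] z_def[symmetric]
        \<Lambda>_def[symmetric] w_def[symmetric]
      by simp
    finally show ?thesis .
  qed
  then show ?thesis
    by (simp add: vec_eq_iff)
qed

lemma kerr_closed_form_continuous:
  assumes "radius p \<noteq> 0" "kerr_Delta m a (radius p) \<noteq> 0"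
  shows "isCont (kerr_closed_form m a) p"
proof -
  have c [continuous_intros]: "isCont radius p"
    unfolding radius_def by (intro continuous_intros)
  have L: "(radius p)\<^sup>2 + a\<^sup>2 * (p$3)\<^sup>2 / (radius p)\<^sup>2 \<noteq> 0"
    using assms(1) by (metis add_pos_nonneg divide_nonneg_nonneg mult_nonneg_nonneg not_less_iff_gr_or_eq
        zero_le_power2 zero_less_power2)
  have D: "(radius p)\<^sup>2 - 2 * m * radius p + a\<^sup>2 \<noteq> 0"
    using assms(2) by (simp add: kerr_Delta_def)
  have n: "isCont (\<lambda>p. d_radius p $ i) p" for i
    using exhaust_4[of i] assms(1)
    by (elim disjE) (simp_all add: d_radius_def continuous_intros)
  have w: "isCont (\<lambda>p. vector [- p$2 / (radius p)\<^sup>2, p$1 / (radius p)\<^sup>2, 0, 0] $ (i::4)) p" for i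
    using exhaust_4[of i] assms(1)
    by (elim disjE) (simp_all add: continuous_intros)
  show ?thesis
    unfolding isCont_def
  proof (intro vec_tendstoI)
    fix i j :: 4
    define N W where "N \<equiv> \<lambda>i q. d_radius q $ i"
      and "W \<equiv> \<lambda>i q. (vector [- q$2 / (radius q)\<^sup>2, q$1 / (radius q)\<^sup>2, 0, 0] :: real^4) $ i"
    define \<Lambda> where "\<Lambda> \<equiv> \<lambda>q::real^4. (radius q)\<^sup>2 + a\<^sup>2 * (q$3)\<^sup>2 / (radius q)\<^sup>2"
    have cN: "isCont (N k) p" and cW: "isCont (W k) p" for k
      using n[of k] w[of k] by (simp_all add: N_def W_def)
    have cL: "isCont \<Lambda> p"
      unfolding \<Lambda>_def using assms(1) by (intro continuous_intros c) auto
    have L': "\<Lambda> p \<noteq> 0"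
      using L by (simp add: \<Lambda>_def)
    have "isCont (\<lambda>q. (- 1 + 2 * m * radius q / \<Lambda> q) * d_time$i * d_time$j
         + \<Lambda> q / ((radius q)\<^sup>2 - 2 * m * radius q + a\<^sup>2) * N i q * N j q
         + \<Lambda> q / (radius q)\<^sup>2 * ((if i = j \<and> i \<noteq> 4 then 1 else 0) - N i q * N j q)
         + a\<^sup>2 * (1 + 2 * m * radius q / \<Lambda> q) * W i q * W j q
         - 2 * m * radius q * a / \<Lambda> q * (d_time$i * W j q + W i q * d_time$j)) p"
      by (intro continuous_intros c cN cW cL) (use assms(1) L' D in simp_all)
    then have "isCont (\<lambda>q. kerr_closed_form m a q $ i $ j) p"
      by (simp only: kerr_closed_form_def Let_def vec_lambda_beta N_def W_def \<Lambda>_def)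
    then show "((\<lambda>q. kerr_closed_form m a q $ i $ j) \<longlongrightarrow> kerr_closed_form m a p $ i $ j) (at p)"
      by (simp add: isCont_def)
  qed
qed

lemma kerr_axis_limit:
  assumes "p \<in> kerr_axis"
  shows "p islimpt - kerr_axis"
  unfolding islimpt_approachable
proof (intro allI impI)
  fix e :: real assume e: "e > 0"
  let ?q = "p + (e/2) *\<^sub>R axis 1 1"
  have "?q \<in> - kerr_axis" "?q \<noteq> p" "dist ?q p < e"
    using assms e by (simp_all add: kerr_axis_def dist_norm)
  then show "\<exists>q\<in>- kerr_axis. q \<noteq> p \<and> dist q p < e"
    by blast
qed

lemma kerr_metric_closed_form:
  assumes "a\<^sup>2 \<le> m\<^sup>2" "0 < m" "p \<in> kerr_exterior m a"
  shows "kerr_metric m a p = kerr_closed_form m a p"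
proof (cases "p \<in> kerr_axis")
  case False
  then show ?thesis
    by (simp add: kerr_metric_def kerr_off_axis_closed_form)
next
  case True
  have "sqrt (m\<^sup>2 - a\<^sup>2) \<le> sqrt (m\<^sup>2 - a\<^sup>2 * (cos (colat p))\<^sup>2)"
    using cos_squared_eq[of "colat p"] by (auto intro!: mult_left_le)
  moreover have "radius p > m + sqrt (m\<^sup>2 - a\<^sup>2 * (cos (colat p))\<^sup>2)"
    using assms(3) by (simp add: kerr_exterior_def)
  ultimately have r: "radius p - m > sqrt (m\<^sup>2 - a\<^sup>2)" "sqrt (m\<^sup>2 - a\<^sup>2) \<ge> 0"
    using assms(1) by (linarith, simp)
  then have "(radius p - m)\<^sup>2 > (sqrt (m\<^sup>2 - a\<^sup>2))\<^sup>2"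
    by (intro power_strict_mono) auto
  then have "kerr_Delta m a (radius p) > 0"
    using assms by (simp add: kerr_Delta_def power2_diff algebra_simps)
  moreover have "radius p \<noteq> 0"
    using r assms(2) by linarith
  ultimately have "isCont (kerr_closed_form m a) p"
    by (intro kerr_closed_form_continuous) auto
  then have "(kerr_closed_form m a \<longlongrightarrow> kerr_closed_form m a p) (at p within - kerr_axis)"
    by (meson isCont_def tendsto_within_subset subset_UNIV)
  moreover have "\<forall>\<^sub>F q in at p within - kerr_axis. kerr_closed_form m a q = kerr_off_axis m a q"
    by (auto simp: eventually_at_filter kerr_off_axis_closed_form)
  ultimately have "(kerr_off_axis m a \<longlongrightarrow> kerr_closed_form m a p) (at p within - kerr_axis)"
    by (rule Lim_transform_eventually)
  then show ?thesis
    using True kerr_axis_limit[OF True]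
    by (auto simp: kerr_metric_def trivial_limit_within intro!: tendsto_Lim)
qed

lemma kerr_exterior_pos:
  assumes "0 < m" "a\<^sup>2 \<le> m\<^sup>2" "p \<in> kerr_exterior m a"
  shows "radius p > m"
proof -
  have "a\<^sup>2 * (cos (colat p))\<^sup>2 \<le> a\<^sup>2"
    using cos_squared_eq[of "colat p"] by (auto intro!: mult_left_le)
  then have "sqrt (m\<^sup>2 - a\<^sup>2 * (cos (colat p))\<^sup>2) \<ge> 0"
    using assms(2) by simp
  moreover have "radius p > m + sqrt (m\<^sup>2 - a\<^sup>2 * (cos (colat p))\<^sup>2)"
    using assms(3) by (simp add: kerr_exterior_def)
  ultimately show ?thesis
    by linarith
qed

text \<open>The topological boundary of the region is the level hypersurface of \<open>kerr_phi\<close>.\<close>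

lemma frontier_kerr_region:
  assumes m: "0 < m" and am: "a\<^sup>2 \<le> m\<^sup>2" and \<epsilon>: "0 < \<epsilon>"
  shows "frontier (kerr_region m a \<epsilon>) = {p \<in> kerr_exterior m a. kerr_phi m a p = \<epsilon> / 2}"
proof -
  define h where "h \<equiv> \<lambda>p. m\<^sup>2 + \<epsilon> - a\<^sup>2 * (p$3 / radius p)\<^sup>2"
  define f where "f \<equiv> \<lambda>p. radius p - m - sqrt (h p)"
  have reg: "kerr_region m a \<epsilon> = {p. f p > 0}"
    by (auto simp: kerr_region_def f_def h_def cos_colat)
  have c: "a\<^sup>2 * (p$3 / radius p)\<^sup>2 \<le> m\<^sup>2" for p
  proof -
    have "a\<^sup>2 * (cos (colat p))\<^sup>2 \<le> a\<^sup>2"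
      using cos_squared_eq[of "colat p"] by (auto intro!: mult_left_le)
    then show ?thesis
      using am by (simp add: cos_colat)
  qed
  then have h: "h p > 0" for p
    using \<epsilon> by (smt (verit) h_def)
  have cr: "isCont radius p" for p
    unfolding radius_def by (intro continuous_intros)
  have cf: "isCont f p" if "radius p > 0" for p
    unfolding f_def h_def using that by (intro continuous_intros cr) auto
  have pos: "radius p > m" if "f p \<ge> 0" for p
    using that h[of p] by (smt (verit) f_def real_sqrt_gt_zero)
  have "open (kerr_region m a \<epsilon>)"
    unfolding open_dist
  proof
    fix p assume "p \<in> kerr_region m a \<epsilon>"
    then have p: "f p > 0"
      by (simp add: reg)
    then have "isCont f p"
      using pos[of p] m by (intro cf) auto
    then have "\<forall>\<^sub>F q in nhds p. f q > 0"
      using p by (intro order_tendstoD) (simp_all add: continuous_within tendsto_at_iff_tendsto_nhds)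
    then show "\<exists>e>0. \<forall>q. dist q p < e \<longrightarrow> q \<in> kerr_region m a \<epsilon>"
      by (simp add: eventually_nhds_metric reg)
  qed
  then have fr: "frontier (kerr_region m a \<epsilon>) = closure (kerr_region m a \<epsilon>) - kerr_region m a \<epsilon>"
    by (simp add: frontier_def interior_open)
  have "p \<in> frontier (kerr_region m a \<epsilon>) \<longleftrightarrow> f p = 0" for p
  proof
    assume "p \<in> frontier (kerr_region m a \<epsilon>)"
    then have p: "p \<in> closure {q. f q > 0}" "\<not> f p > 0"
      using fr unfolding reg by auto
    then obtain X where X: "\<And>n. f (X n) > 0" "X \<longlonglongrightarrow> p"
      unfolding closure_sequential by auto
    have "(\<lambda>n. radius (X n)) \<longlonglongrightarrow> radius p"
      using cr X(2) by (rule isCont_tendsto_compose)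
    moreover have "radius (X n) \<ge> m" for n
      using pos[of "X n"] X(1)[of n] by simp
    ultimately have "radius p \<ge> m"
      by (intro LIMSEQ_le_const) auto
    then have "isCont f p"
      using m by (intro cf) auto
    then have "(\<lambda>n. f (X n)) \<longlonglongrightarrow> f p"
      using X(2) by (rule isCont_tendsto_compose)
    then have "f p \<ge> 0"
      using X(1) by (intro LIMSEQ_le_const) (auto intro: less_imp_le)
    then show "f p = 0"
      using p(2) by simp
  next
    assume p: "f p = 0"
    then have r: "radius p > 0"
      using pos[of p] m by simp
    define X where "X \<equiv> \<lambda>n. (1 + 1 / real (Suc n)) *\<^sub>R p"
    have rX: "radius (t *\<^sub>R p) = t * radius p" if "t > 0" for t
    proof -
      have "(t * p$1)\<^sup>2 + (t * p$2)\<^sup>2 + (t * p$3)\<^sup>2 = t\<^sup>2 * ((p$1)\<^sup>2 + (p$2)\<^sup>2 + (p$3)\<^sup>2)"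
        by algebra
      then show ?thesis
        using that by (simp add: radius_def real_sqrt_mult)
    qed
    have "f (X n) > 0" for n
    proof -
      define t where "t = 1 + 1 / real (Suc n)"
      have t: "t > 1"
        by (simp add: t_def)
      have "h (t *\<^sub>R p) = h p"
        using t by (simp add: h_def rX)
      then have "f (t *\<^sub>R p) = f p + (t - 1) * radius p"
        using t by (simp add: f_def rX algebra_simps)
      then show ?thesis
        using p t r by (simp add: X_def t_def)
    qed
    moreover have "X \<longlonglongrightarrow> (1 + 0) *\<^sub>R p"
      unfolding X_def by (intro tendsto_intros LIMSEQ_inverse_real_of_nat[unfolded inverse_eq_divide])
    ultimately have "p \<in> closure {q. f q > 0}"
      unfolding closure_sequential by auto
    then show "p \<in> frontier (kerr_region m a \<epsilon>)"
      using p fr unfolding reg by auto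
  qed
  moreover have "f p = 0 \<longleftrightarrow> p \<in> kerr_exterior m a \<and> kerr_phi m a p = \<epsilon> / 2" for p
  proof
    assume p: "f p = 0"
    have "sqrt (m\<^sup>2 - a\<^sup>2 * (p$3 / radius p)\<^sup>2) < sqrt (h p)"
      using \<epsilon> by (simp add: h_def)
    then have "p \<in> kerr_exterior m a"
      using p unfolding kerr_exterior_def mem_Collect_eq cos_colat f_def by linarith
    moreover have "(radius p - m)\<^sup>2 = h p"
      using p h[of p] by (simp add: f_def)
    then have "kerr_phi m a p = \<epsilon> / 2"
      by (simp add: kerr_phi_def cos_colat h_def power2_diff field_simps)
    ultimately show "p \<in> kerr_exterior m a \<and> kerr_phi m a p = \<epsilon> / 2"
      by blast
  next
    assume p: "p \<in> kerr_exterior m a \<and> kerr_phi m a p = \<epsilon> / 2"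
    then have "radius p > m"
      using kerr_exterior_pos m am by blast
    moreover have "(radius p - m)\<^sup>2 = h p"
      using p by (simp add: kerr_phi_def cos_colat h_def power2_diff field_simps)
    ultimately have "sqrt (h p) = radius p - m"
      by (intro real_sqrt_unique) auto
    then show "f p = 0"
      by (simp add: f_def)
  qed
  ultimately show ?thesis
    by blast
qed

end

theory Submission
  imports Defs
begin

text \<open>The violating direction is the equatorial rotation field. At the equator the differential of
  the defining function is \<open>(r - m) dr\<close>, so along the rotation field \<open>X\<close> the Hessian is
  \<open>-(r - m)\<close> times the \<open>r\<close>-component of the acceleration of the orbits of \<open>X\<close>, which equals
  \<open>(r - m) \<triangle> (r - m a\<^sup>2 / r\<^sup>2) / r\<^sup>2\<close>. This is positive since \<open>r > 2 m\<close> on the boundary.\<close>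

section \<open>Coordinate calculus: partial derivatives, Christoffel symbols and forms on basis
  vectors\<close>

lemma partial_eq:
  assumes "((\<lambda>s. f (p + s *\<^sub>R axis i 1)) has_real_derivative D) (at 0)"
  shows "partial i f p = D"
  using assms unfolding partial_def by (rule DERIV_imp_deriv)

text \<open>A derivative depends only on the germ of the function. So \<open>h\<close> may be a
  formula valid for small shifts only, such as r + s in place of sqrt ((r + s)^2), which agree for s
  > -r.\<close>

lemma partial_eq_transfer:
  assumes "(h has_real_derivative D) (at 0)"
    and "\<forall>\<^sub>F s in nhds 0. f (p + s *\<^sub>R axis i 1) = h s"
  shows "partial i f p = D"
  using DERIV_cong_ev[OF refl assms(2) refl] assms(1) by (intro partial_eq) blast

text \<open>With a diagonal \<open>k\<close>-th row of the inverse, one term of the sum over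
  \<open>l\<close> survives. It serves for \<open>k = 1\<close>, the radial direction at an
  equatorial point.\<close>

lemma christoffel_diagonal_row:
  assumes "\<And>l. matrix_inv (g p) $ k $ l = (if l = k then c else 0)"
  shows "christoffel g k i j p = c / 2 *
    (partial i (\<lambda>q. g q $ j $ k) p + partial j (\<lambda>q. g q $ i $ k) p - partial k (\<lambda>q. g q $ i $ j) p)"
proof -
  have "(\<Sum>l\<in>UNIV. (if l = k then c else 0) * f l) = c * f k" for f :: "'a \<Rightarrow> real"
    by (simp add: if_distrib[of "\<lambda>x. x * _"] cong: if_cong)
  then show ?thesis
    by (simp add: christoffel_def assms)
qed

lemma sum_sum_axis:
  fixes B :: "'n::finite \<Rightarrow> 'n \<Rightarrow> real"
  shows "(\<Sum>i\<in>UNIV. \<Sum>j\<in>UNIV. B i j * (c *\<^sub>R axis k 1) $ i * (c *\<^sub>R axis k 1) $ j) = c\<^sup>2 * B k k"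
proof -
  have "B i j * (c *\<^sub>R axis k 1) $ i * (c *\<^sub>R axis k 1) $ j =
      (if j = k then if i = k then c\<^sup>2 * B k k else 0 else 0)" for i j
    by (simp add: axis_def power2_eq_square)
  then show ?thesis
    by simp
qed

lemma metric_form_axis:
  "metric_form g p (c *\<^sub>R axis i 1) (c *\<^sub>R axis i 1) = c\<^sup>2 * g p $ i $ i"
  unfolding metric_form_def by (rule sum_sum_axis)

lemma hessian_axis:
  "hessian g f p (c *\<^sub>R axis i 1) (c *\<^sub>R axis i 1) =
    c\<^sup>2 * (partial i (partial i f) p - (\<Sum>k\<in>UNIV. christoffel g k i i p * partial k f p))"
  unfolding hessian_def by (rule sum_sum_axis)

section \<open>Derivatives of the defining function at the equator\<close>

lemma vector_4_add_axis:
  "vector [x, y, z, t] + s *\<^sub>R axis 1 1 = (vector [x + s, y, z, t] :: real^4)"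
  "vector [x, y, z, t] + s *\<^sub>R axis 2 1 = (vector [x, y + s, z, t] :: real^4)"
  "vector [x, y, z, t] + s *\<^sub>R axis 3 1 = (vector [x, y, z + s, t] :: real^4)"
  "vector [x, y, z, t] + s *\<^sub>R axis 4 1 = (vector [x, y, z, t + s] :: real^4)"
  by (simp_all add: vec_eq_iff forall_4 axis_def)

lemma radius_vector: "radius (vector [x, y, z, t]) = sqrt (x\<^sup>2 + y\<^sup>2 + z\<^sup>2)"
  by (simp add: radius_def)

lemma kerr_phi_vector:
  "kerr_phi m a (vector [x, y, z, t]) =
    (1/2) * (x\<^sup>2 + y\<^sup>2 + z\<^sup>2 - 2 * m * sqrt (x\<^sup>2 + y\<^sup>2 + z\<^sup>2) + a\<^sup>2 * (z\<^sup>2 / (x\<^sup>2 + y\<^sup>2 + z\<^sup>2)))"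
  by (simp add: kerr_phi_def cos_colat radius_vector power_divide)

text \<open>At \<open>vector [r, 0, 0, 0]\<close> the differential is (r - m) dx, so only
  Christoffel symbols with upper index 1 enter the Hessian. The partial in direction 2 is kept for
  all \<open>y\<close> because it is differentiated once more in that direction.\<close>

lemma partial_kerr_phi:
  assumes "r > 0"
  shows "partial 1 (kerr_phi m a) (vector [r, 0, 0, 0]) = r - m"
    and "partial 2 (kerr_phi m a) (vector [r, y, 0, 0]) = y * (1 - m / sqrt (r\<^sup>2 + y\<^sup>2))"
    and "partial 3 (kerr_phi m a) (vector [r, 0, 0, 0]) = 0"
    and "partial 4 (kerr_phi m a) (vector [r, 0, 0, 0]) = 0"
proof -
  have "r\<^sup>2 + y\<^sup>2 > 0"
    using assms by (simp add: sum_power2_gt_zero_iff)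
  then show "partial 2 (kerr_phi m a) (vector [r, y, 0, 0]) = y * (1 - m / sqrt (r\<^sup>2 + y\<^sup>2))"
    by (intro partial_eq, unfold vector_4_add_axis kerr_phi_vector)
       (auto simp: field_simps intro!: derivative_eq_intros)
  show "partial 1 (kerr_phi m a) (vector [r, 0, 0, 0]) = r - m"
  proof (rule partial_eq_transfer)
    show "((\<lambda>s. (1/2) * ((r + s)\<^sup>2 - 2 * m * (r + s))) has_real_derivative r - m) (at 0)"
      by (auto intro!: derivative_eq_intros)
    have "\<forall>\<^sub>F s in nhds 0. - r < s"
      using assms eventually_nhds_in_open[of "{- r<..}" 0] by simp
    then show "\<forall>\<^sub>F s in nhds 0. kerr_phi m a (vector [r, 0, 0, 0] + s *\<^sub>R axis 1 1) =
        (1/2) * ((r + s)\<^sup>2 - 2 * m * (r + s))"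
      by eventually_elim (simp add: vector_4_add_axis kerr_phi_vector)
  qed
  show "partial 3 (kerr_phi m a) (vector [r, 0, 0, 0]) = 0"
    using assms
    by (intro partial_eq, unfold vector_4_add_axis kerr_phi_vector)
       (auto simp: field_simps intro!: derivative_eq_intros)
  show "partial 4 (kerr_phi m a) (vector [r, 0, 0, 0]) = 0"
    by (intro partial_eq) (auto simp: vector_4_add_axis kerr_phi_vector)
qed

lemma partial_partial_kerr_phi:
  assumes "r > 0"
  shows "partial 2 (partial 2 (kerr_phi m a)) (vector [r, 0, 0, 0]) = 1 - m / r"
  using assms
  by (intro partial_eq)
     (auto simp: vector_4_add_axis partial_kerr_phi intro!: derivative_eq_intros)

section \<open>The Kerr metric in the equatorial plane, and the Hessian there\<close>

lemma kerr_metric_equator: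
  assumes "x\<^sup>2 + y\<^sup>2 > 0"
  defines "r \<equiv> sqrt (x\<^sup>2 + y\<^sup>2)"
  shows "kerr_metric m a (vector [x, y, 0, 0]) = (\<chi> i j.
           (- 1 + 2 * m / r) * d_time$i * d_time$j
         + r\<^sup>2 / (r\<^sup>2 - 2 * m * r + a\<^sup>2) * vector [x / r, y / r, 0, 0]$i * vector [x / r, y / r, 0, 0]$j
         + ((if i = j \<and> i \<noteq> 4 then 1 else 0) - vector [x / r, y / r, 0, 0]$i * vector [x / r, y / r, 0, 0]$j)
         + a\<^sup>2 * (1 + 2 * m / r) * vector [- y / r\<^sup>2, x / r\<^sup>2, 0, 0]$i * vector [- y / r\<^sup>2, x / r\<^sup>2, 0, 0]$j
         - 2 * m * a / r * (d_time$i * vector [- y / r\<^sup>2, x / r\<^sup>2, 0, 0]$j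
             + vector [- y / r\<^sup>2, x / r\<^sup>2, 0, 0]$i * d_time$j))"
proof -
  have "r > 0"
    using assms by simp
  moreover have "radius (vector [x, y, 0, 0]) = r"
    by (simp add: r_def radius_vector)
  \<comment> \<open>Off the axis no limit enters the metric, so the closed form with z = 0
    applies.\<close>
  moreover have "vector [x, y, 0, 0] \<notin> kerr_axis"
    using assms by (auto simp: kerr_axis_def)
  ultimately show ?thesis
    by (simp add: kerr_metric_def kerr_off_axis_closed_form kerr_closed_form_def Let_def d_radius_def
        power2_eq_square mult.assoc)
qed

lemma kerr_metric_equator_22:
  assumes "x > 0"
  shows "kerr_metric m a (vector [x, 0, 0, 0]) $ 2 $ 2 = 1 + a\<^sup>2 * (1 + 2 * m / x) / x\<^sup>2"
  using assms by (simp add: kerr_metric_equator d_time_def power2_eq_square)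

text \<open>The entry is 0 at y = 0, but its y-derivative enters the Christoffel symbol with upper
  index 1 and lower indices 2, 2. Factoring out \<open>x * y\<close> isolates that
  derivative.\<close>

lemma kerr_metric_equator_21:
  assumes "x > 0"
  shows "kerr_metric m a (vector [x, y, 0, 0]) $ 2 $ 1 =
    x * y * (1 / (x\<^sup>2 + y\<^sup>2 - 2 * m * sqrt (x\<^sup>2 + y\<^sup>2) + a\<^sup>2) - 1 / (x\<^sup>2 + y\<^sup>2)
      - a\<^sup>2 * (1 + 2 * m / sqrt (x\<^sup>2 + y\<^sup>2)) / (x\<^sup>2 + y\<^sup>2)\<^sup>2)"
proof -
  define r where "r = sqrt (x\<^sup>2 + y\<^sup>2)"
  have "x\<^sup>2 + y\<^sup>2 > 0"
    using assms by (simp add: sum_power2_gt_zero_iff)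
  then have r: "r > 0" "x\<^sup>2 + y\<^sup>2 = r\<^sup>2"
    by (auto simp: r_def)
  show ?thesis
    unfolding kerr_metric_equator[OF \<open>x\<^sup>2 + y\<^sup>2 > 0\<close>] r_def[symmetric] r(2)
    using r(1) by (simp add: d_time_def power2_eq_square add_divide_distrib algebra_simps)
qed

text \<open>At this point the Gram matrix splits into single entries for x and z and a 2x2 block in
  y and t, so the row of x can be read off once that block is invertible.\<close>

lemma matrix_inv_kerr_metric_equator:
  assumes r: "r > 0" and D: "r\<^sup>2 - 2 * m * r + a\<^sup>2 \<noteq> 0"
  shows "matrix_inv (kerr_metric m a (vector [r, 0, 0, 0])) $ 1 $ l =
    (if l = 1 then (r\<^sup>2 - 2 * m * r + a\<^sup>2) / r\<^sup>2 else 0)"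
proof -
  define D where "D = r\<^sup>2 - 2 * m * r + a\<^sup>2"
  define G where "G = kerr_metric m a (vector [r, 0, 0, 0])"
  define A B C where "A = 1 + a\<^sup>2 * (1 + 2 * m / r) / r\<^sup>2" and "B = - (2 * m * a / r\<^sup>2)"
    and "C = - 1 + 2 * m / r"
  have G: "G = vector [vector [r\<^sup>2 / D, 0, 0, 0], vector [0, A, 0, B], vector [0, 0, 1, 0], vector [0, B, 0, C]]"
    using r by (simp add: G_def kerr_metric_equator vec_eq_iff forall_4 d_time_def A_def B_def C_def D_def
        power2_eq_square)
  \<comment> \<open>Since d\<phi> = dy / r here, the y-t determinant is that of the (\<phi>, t)
    block, which is \<open>- D\<close> on the equator, divided by r^2.\<close>
  have "A * C - B * B = - D / r\<^sup>2"
    using r by (simp add: A_def B_def C_def D_def field_simps) algebra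
  then have det: "A * C - B * B \<noteq> 0"
    using r D by (simp add: D_def)
  define d where "d = A * C - B * B"
  define H :: "real^4^4" where "H = vector [vector [D / r\<^sup>2, 0, 0, 0], vector [0, C / d, 0, - B / d],
      vector [0, 0, 1, 0], vector [0, - B / d, 0, A / d]]"
  have "D \<noteq> 0" "d \<noteq> 0"
    using D det by (simp_all add: D_def d_def)
  then have "G ** H = mat 1" "H ** G = mat 1"
    using r by (simp_all add: G H_def matrix_matrix_mult_def mat_def vec_eq_iff forall_4 sum_4
        field_simps) (simp_all add: d_def algebra_simps)
  \<comment> \<open>\<open>matrix_inv\<close> is defined by choice: \<open>H\<close> witnesses that
    a two-sided inverse exists, and uniqueness of inverses then identifies the chosen one with
    \<open>H\<close>.\<close>
  then have "matrix_inv G ** G = mat 1"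
    unfolding matrix_inv_def by (rule someI2[where a = H, OF conjI]) simp
  then have "matrix_inv G = matrix_inv G ** (G ** H)"
    by (simp add: \<open>G ** H = mat 1\<close>)
  also have "\<dots> = H"
    by (simp add: matrix_mul_assoc \<open>matrix_inv G ** G = mat 1\<close>)
  finally have "matrix_inv G = H" .
  then show ?thesis
    using exhaust_4[of l] by (auto simp: G_def[symmetric] H_def D_def[symmetric])
qed

lemma partial_kerr_metric_22:
  assumes "r > 0"
  shows "partial 1 (\<lambda>q. kerr_metric m a q $ 2 $ 2) (vector [r, 0, 0, 0]) = - 2 * a\<^sup>2 / r^3 - 6 * m * a\<^sup>2 / r^4"
proof (rule partial_eq_transfer)
  show "((\<lambda>s. 1 + a\<^sup>2 * (1 + 2 * m / (r + s)) / (r + s)\<^sup>2) has_real_derivative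
      - 2 * a\<^sup>2 / r^3 - 6 * m * a\<^sup>2 / r^4) (at 0)"
    using assms by (auto intro!: derivative_eq_intros simp: field_simps eval_nat_numeral)
  have "\<forall>\<^sub>F s in nhds 0. - r < s"
    using assms eventually_nhds_in_open[of "{- r<..}" 0] by simp
  then show "\<forall>\<^sub>F s in nhds 0. kerr_metric m a (vector [r, 0, 0, 0] + s *\<^sub>R axis 1 1) $ 2 $ 2 =
      1 + a\<^sup>2 * (1 + 2 * m / (r + s)) / (r + s)\<^sup>2"
    by eventually_elim (simp add: vector_4_add_axis kerr_metric_equator_22)
qed

lemma partial_kerr_metric_21:
  assumes "r > 0" and D: "r\<^sup>2 - 2 * m * r + a\<^sup>2 \<noteq> 0"
  shows "partial 2 (\<lambda>q. kerr_metric m a q $ 2 $ 1) (vector [r, 0, 0, 0]) =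
    r * (1 / (r\<^sup>2 - 2 * m * r + a\<^sup>2) - 1 / r\<^sup>2 - a\<^sup>2 * (1 + 2 * m / r) / r^4)"
proof (rule partial_eq)
  define h where "h s = 1 / (r\<^sup>2 + s\<^sup>2 - 2 * m * sqrt (r\<^sup>2 + s\<^sup>2) + a\<^sup>2) - 1 / (r\<^sup>2 + s\<^sup>2)
      - a\<^sup>2 * (1 + 2 * m / sqrt (r\<^sup>2 + s\<^sup>2)) / (r\<^sup>2 + s\<^sup>2)\<^sup>2" for s
  \<comment> \<open>\<open>h\<close> depends on \<open>s\<close> through s^2 only, so its derivative
    vanishes at 0, and the product rule for \<open>r * s * h s\<close> leaves
    \<open>r * h 0\<close>.\<close>
  have "(h has_real_derivative 0) (at 0)"
    unfolding h_def using assms by (auto intro!: derivative_eq_intros)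
  then have "((\<lambda>s. r * s * h s) has_real_derivative r * h 0) (at 0)"
    by (auto intro!: derivative_eq_intros)
  then show "((\<lambda>s. kerr_metric m a (vector [r, 0, 0, 0] + s *\<^sub>R axis 2 1) $ 2 $ 1) has_real_derivative
      r * (1 / (r\<^sup>2 - 2 * m * r + a\<^sup>2) - 1 / r\<^sup>2 - a\<^sup>2 * (1 + 2 * m / r) / r^4)) (at 0)"
    using assms(1) by (simp add: vector_4_add_axis kerr_metric_equator_21 h_def)
qed

lemma hessian_kerr_phi_equator:
  assumes r: "r > 0" and D: "r\<^sup>2 - 2 * m * r + a\<^sup>2 \<noteq> 0"
  shows "hessian (kerr_metric m a) (kerr_phi m a) (vector [r, 0, 0, 0]) (r *\<^sub>R axis 2 1) (r *\<^sub>R axis 2 1) =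
    (r - m) * (r\<^sup>2 - 2 * m * r + a\<^sup>2) * (r - m * a\<^sup>2 / r\<^sup>2) / r\<^sup>2"
proof -
  define p :: "real^4" where "p = vector [r, 0, 0, 0]"
  define D where "D = r\<^sup>2 - 2 * m * r + a\<^sup>2"
  have D0: "D \<noteq> 0"
    using D by (simp add: D_def)
  have "christoffel (kerr_metric m a) 1 2 2 p = D / r\<^sup>2 / 2 *
      (2 * (r * (1 / D - 1 / r\<^sup>2 - a\<^sup>2 * (1 + 2 * m / r) / r^4)) - (- 2 * a\<^sup>2 / r^3 - 6 * m * a\<^sup>2 / r^4))"
    unfolding p_def D_def
    by (subst christoffel_diagonal_row[where k = 1 and p = "vector [r, 0, 0, 0]"
          and g = "kerr_metric m a", OF matrix_inv_kerr_metric_equator[OF r D]])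
       (simp add: partial_kerr_metric_21[OF r D] partial_kerr_metric_22[OF r])
  \<comment> \<open>The term \<open>1 / r\<close> is split off because its contribution
    \<open>(r - m) / r\<close> cancels the second partial \<open>1 - m / r\<close> of
    \<open>kerr_phi\<close>; the rest gives the product in the claim.\<close>
  also have "\<dots> = 1 / r - D / r^3 * (1 - m * a\<^sup>2 / r^3)"
    using r D0 by (simp add: field_simps eval_nat_numeral)
  finally have c: "christoffel (kerr_metric m a) 1 2 2 p = 1 / r - D / r^3 * (1 - m * a\<^sup>2 / r^3)" .
  have "hessian (kerr_metric m a) (kerr_phi m a) p (r *\<^sub>R axis 2 1) (r *\<^sub>R axis 2 1) =
      r\<^sup>2 * (1 - m / r - (1 / r - D / r^3 * (1 - m * a\<^sup>2 / r^3)) * (r - m))"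
    by (simp add: hessian_axis sum_4 c) (simp add: p_def r partial_kerr_phi partial_partial_kerr_phi)
  also have "\<dots> = (r - m) * D * (r - m * a\<^sup>2 / r\<^sup>2) / r\<^sup>2"
    using r by (simp add: field_simps eval_nat_numeral)
  finally show ?thesis
    by (simp add: p_def D_def)
qed

section \<open>The equatorial boundary circle contradicts convexity\<close>

theorem corollary2:
  fixes m a \<epsilon> :: real
  assumes "m > 0"
    and "a\<^sup>2 \<le> m\<^sup>2"
    and "\<epsilon> > 0"
  shows "\<not> space_convex (kerr_metric m a) (kerr_phi m a) (kerr_region m a \<epsilon>)"
proof
  assume convex: "space_convex (kerr_metric m a) (kerr_phi m a) (kerr_region m a \<epsilon>)"
  \<comment> \<open>The boundary radius at the equator, where cos \<theta> = 0: the larger root of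
    r^2 - 2 m r = \<epsilon>.\<close>
  define r where "r = m + sqrt (m\<^sup>2 + \<epsilon>)"
  have "sqrt (m\<^sup>2 + \<epsilon>) > sqrt (m\<^sup>2)"
    using assms by (intro real_sqrt_less_mono) simp
  then have r2m: "r > 2 * m"
    using assms by (simp add: r_def)
  then have r: "r > 0"
    using assms by simp
  have "(r - m)\<^sup>2 = m\<^sup>2 + \<epsilon>"
    using assms by (simp add: r_def)
  then have r\<epsilon>: "r\<^sup>2 - 2 * m * r = \<epsilon>"
    by (simp add: power2_diff algebra_simps)
  \<comment> \<open>By the boundary equation the left side is \<epsilon> + a^2.\<close>
  then have D: "r\<^sup>2 - 2 * m * r + a\<^sup>2 > 0"
    using assms by (simp add: add_pos_nonneg)
  \<comment> \<open>An orbit of the rotation field at fixed time. It stays in the boundary, so its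
    velocity at \<open>s = 0\<close> is a tangent vector there.\<close>
  define \<gamma> :: "real \<Rightarrow> real^4" where "\<gamma> s = (r * cos s) *\<^sub>R axis 1 1 + (r * sin s) *\<^sub>R axis 2 1" for s
  have \<gamma>: "\<gamma> s = vector [r * cos s, r * sin s, 0, 0]" for s
    by (simp add: \<gamma>_def vec_eq_iff forall_4 axis_def)
  have "\<gamma> s \<in> frontier (kerr_region m a \<epsilon>)" for s
  proof -
    have "(r * cos s)\<^sup>2 + (r * sin s)\<^sup>2 = r\<^sup>2 * ((sin s)\<^sup>2 + (cos s)\<^sup>2)"
      by algebra
    then have "(r * cos s)\<^sup>2 + (r * sin s)\<^sup>2 = r\<^sup>2"
      by simp
    then show ?thesis
      using r r2m r\<epsilon> assms
      by (simp add: frontier_kerr_region kerr_exterior_def \<gamma> kerr_phi_vector cos_colat radius_vector)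
  qed
  moreover have "(\<gamma> has_vector_derivative r *\<^sub>R axis 2 1) (at 0)"
    unfolding \<gamma>_def by (auto intro!: derivative_eq_intros)
  moreover have "\<gamma> 0 = vector [r, 0, 0, 0]"
    by (simp add: \<gamma>)
  ultimately have p: "vector [r, 0, 0, 0] \<in> frontier (kerr_region m a \<epsilon>)"
    and "r *\<^sub>R axis 2 1 \<in> tangent_vectors (frontier (kerr_region m a \<epsilon>)) (vector [r, 0, 0, 0])"
    unfolding tangent_vectors_def by (metis, fastforce)
  \<comment> \<open>This is the Cartesian 2, 2 entry, i.e. g_33 of the line element divided by r^2;
    its sign makes the rotation field spacelike.\<close>
  moreover have "1 + a\<^sup>2 * (1 + 2 * m / r) / r\<^sup>2 > 0"
    using assms r by (intro add_pos_nonneg) auto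
  then have "metric_form (kerr_metric m a) (vector [r, 0, 0, 0]) (r *\<^sub>R axis 2 1) (r *\<^sub>R axis 2 1) > 0"
    using r by (simp add: metric_form_axis kerr_metric_equator_22)
  ultimately have "hessian (kerr_metric m a) (kerr_phi m a) (vector [r, 0, 0, 0])
      (r *\<^sub>R axis 2 1) (r *\<^sub>R axis 2 1) \<le> 0"
    using convex unfolding space_convex_def by blast
  then have "(r - m) * (r\<^sup>2 - 2 * m * r + a\<^sup>2) * (r - m * a\<^sup>2 / r\<^sup>2) / r\<^sup>2 \<le> 0"
    using hessian_kerr_phi_equator[OF r] D by simp
  \<comment> \<open>Since a^2 \<le> m^2 \<le> r^2, the subtracted term is at most \<open>m\<close>,
    and m < r.\<close>
  moreover have "r - m * a\<^sup>2 / r\<^sup>2 > 0"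
  proof -
    have "a\<^sup>2 \<le> r\<^sup>2"
      using assms r2m power_mono[of m r 2] by linarith
    then have "m * (a\<^sup>2 / r\<^sup>2) \<le> m * 1"
      using assms r by (intro mult_left_mono) auto
    then show ?thesis
      using r2m assms by simp
  qed
  ultimately show False
    using D r r2m assms by (simp add: divide_le_0_iff mult_le_0_iff)
qed

end
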